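(* Let $n\ge 0$, $k\ge1$, and let $\pi$ be any permutation of $\{1,2,3\}$. (i) Among the $\binom{n-1}{k-1}$ compositions of $n$ into $k$ positive parts, the number that avoid $\pi$ does not depend on $\pi$. (ii) Among the $\binom{n+k-1}{n}$ compositions of $n$ into $k$ nonnegative parts, the number that avoid $\pi$ does not depend on $\pi$.
   Context: A composition of $n$ into $k$ positive (resp. nonnegative) parts is a sequence $(x_1,\dots,x_k)$ of positive (resp. nonnegative) integers with $x_1+\dots+x_k=n$; order matters. A sequence $(x_1,\dots,x_k)$ contains the pattern $\pi=(\pi_1\pi_2\pi_3)\in S_3$ if there exist indices $i_1<i_2<i_3$ such that for all $a,b\in\{1,2,3\}$, $x_{i_a}<x_{i_b}$ whenever $\pi_a<\pi_b$ (strict inequalities). It avoids $\pi$ if it does not contain $\pi$. *)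

theory Defs
  imports Main "HOL-Combinatorics.Permutations"
begin

definition pos_compositions :: "nat \<Rightarrow> nat \<Rightarrow> nat list set" where
  "pos_compositions n k = {xs. length xs = k \<and> (\<forall>x\<in>set xs. 0 < x) \<and> sum_list xs = n}"

definition nonneg_compositions :: "nat \<Rightarrow> nat \<Rightarrow> nat list set" where
  "nonneg_compositions n k = {xs. length xs = k \<and> sum_list xs = n}"

text \<open>A pattern in the symmetric group on three letters is a function \<open>\<pi>\<close> with
  \<open>\<pi> permutes {1, 2, 3}\<close>, whose one-line notation is \<open>\<pi> 1, \<pi> 2, \<pi> 3\<close>.
  The positions \<open>i 1 < i 2 < i 3\<close> are list positions and so start at 0.\<close>

definition contains_pattern :: "nat list \<Rightarrow> (nat \<Rightarrow> nat) \<Rightarrow> bool" where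
  "contains_pattern xs \<pi> \<longleftrightarrow>
     (\<exists>i :: nat \<Rightarrow> nat. i 1 < i 2 \<and> i 2 < i 3 \<and> i 3 < length xs \<and>
        (\<forall>a\<in>{1, 2, 3}. \<forall>b\<in>{1, 2, 3}. \<pi> a < \<pi> b \<longrightarrow> xs ! i a < xs ! i b))"

definition avoids_pattern :: "nat list \<Rightarrow> (nat \<Rightarrow> nat) \<Rightarrow> bool" where
  "avoids_pattern xs \<pi> \<longleftrightarrow> \<not> contains_pattern xs \<pi>"

end

(* The weak left-to-right minima of a word, with their positions, together with the multiset of
   its letters split the words into classes. If two words u < v of one class (lexicographically)
   first differ at position i, then position i carries no minimum, and the letter that the other
   word has there still occurs later; so u contains 123 and v contains 132. Conversely, swapping
   the last two letters of an occurrence of 123 or 132 stays in the class and makes the word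
   lexicographically larger or smaller. So each class has exactly one word avoiding 123, its
   maximum, and exactly one avoiding 132, its minimum (the idea of Simion and Schmidt).
   Reverse-complement turns 132 into 213 and fixes 123, and reversal yields the other three
   patterns. *)

theory Submission
  imports Defs "HOL-Library.List_Lexorder" "HOL-Combinatorics.Multiset_Permutations"
begin

section \<open>Patterns as predicates on three letters\<close>

definition occurs :: "('a \<Rightarrow> 'a \<Rightarrow> 'a \<Rightarrow> bool) \<Rightarrow> 'a list \<Rightarrow> bool" where
  "occurs P xs \<longleftrightarrow> (\<exists>i j k. i < j \<and> j < k \<and> k < length xs \<and> P (xs ! i) (xs ! j) (xs ! k))"

text \<open>Three patterns suffice, since the other three are their reversals. Any linear order is
  allowed because complemented words will have negative integer letters.\<close>

definition p123 :: "'a::linorder \<Rightarrow> 'a \<Rightarrow> 'a \<Rightarrow> bool" where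
  "p123 x y z \<longleftrightarrow> x < y \<and> y < z"

definition p132 :: "'a::linorder \<Rightarrow> 'a \<Rightarrow> 'a \<Rightarrow> bool" where
  "p132 x y z \<longleftrightarrow> x < z \<and> z < y"

definition p213 :: "'a::linorder \<Rightarrow> 'a \<Rightarrow> 'a \<Rightarrow> bool" where
  "p213 x y z \<longleftrightarrow> y < x \<and> x < z"

lemma occurs_rev: "occurs P (rev xs) \<longleftrightarrow> occurs (\<lambda>x y z. P z y x) xs"
proof -
  have *: "occurs (\<lambda>x y z. P z y x) (rev xs)" if "occurs P xs" for P and xs :: "'a list"
  proof -
    from that obtain i j k where "i < j" "j < k" "k < length xs" "P (xs ! i) (xs ! j) (xs ! k)"
      unfolding occurs_def by blast
    then show ?thesis
      unfolding occurs_def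
      by (intro exI[of _ "length xs - Suc k"] exI[of _ "length xs - Suc j"]
            exI[of _ "length xs - Suc i"]) (auto simp: rev_nth)
  qed
  \<comment> \<open>Reversing the word and flipping the predicate are both involutions, so one
    implication gives both directions.\<close>
  show ?thesis
    using *[of P "rev xs"] *[of "\<lambda>x y z. P z y x" xs] by auto
qed

lemma occurs_map: "occurs P (map f xs) \<longleftrightarrow> occurs (\<lambda>x y z. P (f x) (f y) (f z)) xs"
  unfolding occurs_def by (intro ex_cong1) auto

section \<open>Left-to-right minima and lexicographic order\<close>

definition lr_minima :: "'a::linorder list \<Rightarrow> nat \<Rightarrow> 'a option" where
  "lr_minima xs i =
     (if i < length xs \<and> (\<forall>j<i. xs ! i \<le> xs ! j) then Some (xs ! i) else None)"

lemma occurs_of_less: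
  fixes u v :: "'a::linorder list"
  assumes mset: "mset u = mset v" and minima: "lr_minima u = lr_minima v" and less: "u < v"
  shows "occurs p123 u" and "occurs p132 v"
proof -
  have len: "length u = length v"
    using mset by (rule mset_eq_length)
  then obtain i where i: "i < length u" "take i u = take i v" "u ! i < v ! i"
    using less unfolding list_less_def lexord_take_index_conv by auto
  have eq: "u ! j = v ! j" if "j < i" for j
    using i(2) that by (metis nth_take)
  \<comment> \<open>A minimum of \<open>u\<close> at \<open>i\<close> would be recorded for
    \<open>v\<close> with the same value, but the letters differ there.\<close>
  have "\<not> (\<forall>j<i. u ! i \<le> u ! j)"
  proof
    assume *: "\<forall>j<i. u ! i \<le> u ! j"
    then have "lr_minima v i = Some (u ! i)"
      using i minima by (metis lr_minima_def)
    then show False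
      using i(3) by (auto simp: lr_minima_def split: if_splits)
  qed
  then obtain j where j: "j < i" "u ! j < u ! i"
    by auto
  have drop: "mset (drop i u) = mset (drop i v)"
    using mset i(2) by (metis append_take_drop_id mset_append add_left_cancel)
  have neq: "u ! i \<noteq> v ! i"
    using i(3) by (rule less_imp_neq)
  \<comment> \<open>The suffixes from \<open>i\<close> on have the same letters but different first
    letters, so the first letter of one occurs later in the other.\<close>
  have later: "\<exists>k. i < k \<and> k < length x \<and> x ! k = y ! i"
    if "length x = length y" "i < length y" "mset (drop i x) = mset (drop i y)" "x ! i \<noteq> y ! i"
    for x y :: "'a list"
  proof -
    have "y ! i \<in> set (drop i y)"
      using that(2) by (metis Cons_nth_drop_Suc list.set_intros(1))
    then have "y ! i \<in> set (drop i x)"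
      using that(3) by (metis set_mset_mset)
    then obtain l where l: "l < length x - i" "x ! (i + l) = y ! i"
      by (auto simp: in_set_conv_nth)
    then have "l \<noteq> 0"
      using that(4) by (metis add_0_right)
    with l show ?thesis
      by (intro exI[of _ "i + l"]) auto
  qed
  obtain k where "i < k" "k < length u" "u ! k = v ! i"
    using later[of u v] len i(1) drop neq by metis
  \<comment> \<open>The three letters are \<open>u ! j\<close>, \<open>u ! i\<close> and
    \<open>v ! i\<close>, in increasing order; in \<open>v\<close> the last two appear in the
    opposite order.\<close>
  then show "occurs p123 u"
    using i j unfolding occurs_def p123_def by metis
  obtain k where "i < k" "k < length v" "v ! k = u ! i"
    using later[of v u] len i(1) drop neq by metis
  then show "occurs p132 v"
    using i j eq unfolding occurs_def p132_def by metis
qed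

text \<open>The letter at \<open>h\<close> lies strictly below both swapped letters and precedes
  them, so neither \<open>i\<close> nor \<open>k\<close> carries a minimum before or after the swap.
  At any other position after \<open>i\<close>, being at most \<open>u ! h\<close> already implies
  being at most both swapped letters.\<close>

lemma lr_minima_swap:
  fixes u :: "'a::linorder list"
  assumes "h < i" "i < k" "k < length u" "u ! h < u ! i" "u ! h < u ! k"
  shows "lr_minima (u[i := u ! k, k := u ! i]) = lr_minima u"
proof
  fix p
  define v where "v = u[i := u ! k, k := u ! i]"
  have v: "v ! q = (if q = k then u ! i else if q = i then u ! k else u ! q)"
    if "q < length u" for q
    using that assms unfolding v_def by (auto simp: nth_list_update)
  have len: "length v = length u"
    by (simp add: v_def)
  have "lr_minima v p = lr_minima u p"
  proof (cases "p < length u")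
    case p: True
    consider "p < i" | "p = i" | "p = k" | "i < p" "p \<noteq> k"
      by linarith
    then show ?thesis
    proof cases
      case 1
      then have "v ! q = u ! q" if "q \<le> p" for q
        using that p assms v by simp
      then show ?thesis
        by (simp add: lr_minima_def len)
    next
      case 2
      then have "v ! h < v ! p" "u ! h < u ! p"
        using p assms v by auto
      then show ?thesis
        using 2 assms(1) unfolding lr_minima_def by (auto simp: not_le)
    next
      case 3
      then have "v ! h < v ! p" "u ! h < u ! p"
        using p assms v by auto
      then show ?thesis
        using 3 assms(1,2) less_trans[of h i k] unfolding lr_minima_def
        by (metis not_le)
    next
      case 4
      have [simp]: "v ! p = u ! p" "v ! h = u ! h"
        using 4 p assms v by auto
      have h: "h < p"
        using 4 assms by simp
      have "(\<forall>q<p. u ! p \<le> v ! q) \<longleftrightarrow> (\<forall>q<p. u ! p \<le> u ! q)" (is "?L \<longleftrightarrow> ?R")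
      proof
        assume ?L
        then have "u ! p \<le> u ! h"
          using h by (metis \<open>v ! h = u ! h\<close>)
        show ?R
        proof (intro allI impI)
          fix q assume "q < p"
          then have "u ! p \<le> v ! q" "q < length u"
            using \<open>?L\<close> p by auto
          then show "u ! p \<le> u ! q"
            using \<open>u ! p \<le> u ! h\<close> assms v[of q] by (auto split: if_splits)
        qed
      next
        assume ?R
        then have "u ! p \<le> u ! h"
          using h by blast
        show ?L
        proof (intro allI impI)
          fix q assume "q < p"
          then have "u ! p \<le> u ! q" "q < length u"
            using \<open>?R\<close> p by auto
          then show "u ! p \<le> v ! q"
            using \<open>u ! p \<le> u ! h\<close> assms v[of q] by auto
        qed
      qed
      then show ?thesis
        by (simp add: lr_minima_def len)
    qed
  qed (simp add: lr_minima_def len)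
  then show "lr_minima (u[i := u ! k, k := u ! i]) p = lr_minima u p"
    by (simp add: v_def)
qed

lemma swap_less:
  fixes u :: "'a::linorder list"
  assumes "i < k" "k < length u"
  shows "u ! i < u ! k \<Longrightarrow> u < u[i := u ! k, k := u ! i]"
    and "u ! k < u ! i \<Longrightarrow> u[i := u ! k, k := u ! i] < u"
  using assms unfolding list_less_def lexord_take_index_conv
  by (auto intro!: exI[of _ i])

text \<open>The one property of compositions that the pattern counts rely on: such a set is a union
  of whole classes, and reversal maps it onto itself.\<close>

definition perm_closed :: "'a list set \<Rightarrow> bool" where
  "perm_closed A \<longleftrightarrow> (\<forall>xs ys. xs \<in> A \<longrightarrow> mset ys = mset xs \<longrightarrow> ys \<in> A)"

lemma finite_mset_eq: "finite {xs. mset xs = M}"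
  using finite_permutations_of_multiset[of M] by (simp add: permutations_of_multiset_def)

lemma exists_avoider:
  fixes u :: "'a::linorder list"
  obtains v w where "mset v = mset u" "lr_minima v = lr_minima u" "\<not> occurs p123 v"
    "mset w = mset u" "lr_minima w = lr_minima u" "\<not> occurs p132 w"
proof -
  \<comment> \<open>The class of \<open>u\<close>; it is finite, so its lexicographic
    \<open>Max\<close> and \<open>Min\<close> exist and serve as \<open>v\<close> and
    \<open>w\<close>.\<close>
  define C where "C = {v. mset v = mset u \<and> lr_minima v = lr_minima u}"
  have fin: "finite C"
    unfolding C_def by (rule finite_subset[OF _ finite_mset_eq[of "mset u"]]) auto
  have "u \<in> C"
    by (simp add: C_def)
  then have ne: "C \<noteq> {}"
    by blast
  have swap: "x[i := x ! k, k := x ! i] \<in> C"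
    if "x \<in> C" "h < i" "i < k" "k < length x" "x ! h < x ! i" "x ! h < x ! k" for x h i k
  proof -
    have "mset (x[i := x ! k, k := x ! i]) = mset x"
      using that mset_swap[of k x i] by (simp add: list_update_swap)
    with that show ?thesis
      using lr_minima_swap[of h i k x] by (simp add: C_def)
  qed
  have max: "\<not> occurs p123 (Max C)"
  proof
    let ?x = "Max C"
    assume "occurs p123 ?x"
    then obtain h i k where *: "h < i" "i < k" "k < length ?x" "?x ! h < ?x ! i" "?x ! i < ?x ! k"
      unfolding occurs_def p123_def by blast
    then have "?x[i := ?x ! k, k := ?x ! i] \<in> C"
      using swap[of ?x h i k] Max_in[OF fin ne] by (auto intro: less_trans)
    then show False
      using swap_less(1)[of i k ?x] * Max_ge[OF fin] by (meson not_le)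
  qed
  have min: "\<not> occurs p132 (Min C)"
  proof
    let ?x = "Min C"
    assume "occurs p132 ?x"
    then obtain h i k where *: "h < i" "i < k" "k < length ?x" "?x ! h < ?x ! k" "?x ! k < ?x ! i"
      unfolding occurs_def p132_def by blast
    then have "?x[i := ?x ! k, k := ?x ! i] \<in> C"
      using swap[of ?x h i k] Min_in[OF fin ne] by (auto intro: less_trans)
    then show False
      using swap_less(2)[of i k ?x] * Min_le[OF fin] by (meson not_le)
  qed
  show ?thesis
    using that[of "Max C" "Min C"] max min Max_in[OF fin ne] Min_in[OF fin ne]
    by (auto simp: C_def)
qed

text \<open>Both sides count the classes that meet \<open>A\<close>, that is, the values of
  \<open>sig\<close> on \<open>A\<close>: a class contains at most one avoider by
  \<open>occurs_of_less\<close> and at least one by \<open>exists_avoider\<close>.\<close>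

lemma card_avoid_123_132:
  fixes A :: "'a::linorder list set"
  assumes "perm_closed A"
  shows "card {xs \<in> A. \<not> occurs p123 xs} = card {xs \<in> A. \<not> occurs p132 xs}"
proof -
  define sig where "sig = (\<lambda>xs :: 'a list. (mset xs, lr_minima xs))"
  have inj: "inj_on sig {xs \<in> A. \<not> occurs P xs}"
    if "P = p123 \<or> P = p132" for P
  proof (rule inj_onI)
    fix u v
    assume *: "u \<in> {xs \<in> A. \<not> occurs P xs}" "v \<in> {xs \<in> A. \<not> occurs P xs}" "sig u = sig v"
    show "u = v"
      using occurs_of_less[of u v] occurs_of_less[of v u] * that
      by (cases u v rule: linorder_cases) (auto simp: sig_def)
  qed
  have onto: "sig ` {xs \<in> A. \<not> occurs P xs} = sig ` A"
    if P: "P = p123 \<or> P = p132" for P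
  proof (intro equalityI subsetI)
    fix s assume "s \<in> sig ` A"
    then obtain u where u: "u \<in> A" "s = sig u"
      by blast
    obtain v where "mset v = mset u" "lr_minima v = lr_minima u" "\<not> occurs P v"
      using exists_avoider[of u] P by metis
    with u assms have "v \<in> {xs \<in> A. \<not> occurs P xs}" "sig v = s"
      by (auto simp: sig_def perm_closed_def)
    then show "s \<in> sig ` {xs \<in> A. \<not> occurs P xs}"
      by blast
  qed auto
  have "card {xs \<in> A. \<not> occurs P xs} = card (sig ` A)"
    if "P = p123 \<or> P = p132" for P
    using card_image[OF inj[OF that]] onto[OF that] by simp
  then show ?thesis
    by simp
qed

section \<open>Transport along reversal and letterwise maps\<close>

lemma card_avoid_image:
  assumes "inj_on f A" "\<And>xs. xs \<in> A \<Longrightarrow> occurs P (f xs) \<longleftrightarrow> occurs Q xs"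
  shows "card {ys \<in> f ` A. \<not> occurs P ys} = card {xs \<in> A. \<not> occurs Q xs}"
proof -
  have "{ys \<in> f ` A. \<not> occurs P ys} = f ` {xs \<in> A. \<not> occurs Q xs}"
    using assms(2) by auto
  then show ?thesis
    using assms(1) by (simp add: card_image inj_on_subset)
qed

lemma perm_closed_rev_image:
  assumes "perm_closed A"
  shows "rev ` A = A"
proof -
  have "rev xs \<in> A" if "xs \<in> A" for xs
    using that assms by (simp add: perm_closed_def)
  then show ?thesis
    by (metis image_subsetI rev_rev_ident subsetI subset_antisym image_eqI)
qed

lemma card_avoid_rev:
  assumes "perm_closed A"
  shows "card {xs \<in> A. \<not> occurs (\<lambda>x y z. P z y x) xs} = card {xs \<in> A. \<not> occurs P xs}"
  using card_avoid_image[of rev A P "\<lambda>x y z. P z y x"] perm_closed_rev_image[OF assms]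
  by (simp add: occurs_rev)

lemma perm_closed_map_image:
  assumes "perm_closed A"
  shows "perm_closed (map f ` A)"
  unfolding perm_closed_def
proof (intro allI impI)
  fix xs ys assume "xs \<in> map f ` A" and eq: "mset ys = mset xs"
  then obtain u where u: "u \<in> A" "xs = map f u"
    by blast
  \<comment> \<open>A rearrangement of the mapped word permutes positions; the same permutation
    applied to \<open>u\<close> stays in \<open>A\<close>.\<close>
  obtain p where p: "p permutes {..<length xs}" "permute_list p xs = ys"
    using mset_eq_permutation[OF eq] by blast
  then have "ys = map f (permute_list p u)"
    using u by (simp add: permute_list_map)
  moreover have "permute_list p u \<in> A"
    using u p assms by (simp add: perm_closed_def)
  ultimately show "ys \<in> map f ` A"
    by blast
qed

text \<open>Negation into the integers complements the letters without fixing an upper bound for them.\<close>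

lemma card_avoid_123_213:
  fixes A :: "nat list set"
  assumes "perm_closed A"
  shows "card {xs \<in> A. \<not> occurs p213 xs} = card {xs \<in> A. \<not> occurs p123 xs}"
proof -
  let ?f = "map (\<lambda>x. - int x)"
  have inj: "inj_on ?f A"
    by (rule inj_on_subset[of _ UNIV]) (auto simp: inj_def)
  \<comment> \<open>Reversal turns 213 into 312 and negation turns that into 132. After the passage
    to 123, negation gives 321 and reversal gives 123 again.\<close>
  have "card {xs \<in> A. \<not> occurs p213 xs}
      = card {xs \<in> A. \<not> occurs (\<lambda>x y z. y < z \<and> z < x) xs}"
    using card_avoid_rev[OF assms, of p213] by (simp add: p213_def)
  also have "\<dots> = card {ys \<in> ?f ` A. \<not> occurs p132 ys}"
    by (rule card_avoid_image[OF inj, symmetric]) (auto simp: occurs_map p132_def conj_commute)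
  also have "\<dots> = card {ys \<in> ?f ` A. \<not> occurs p123 ys}"
    by (rule card_avoid_123_132[OF perm_closed_map_image[OF assms], symmetric])
  also have "\<dots> = card {xs \<in> A. \<not> occurs (\<lambda>x y z. y < x \<and> z < y) xs}"
    by (rule card_avoid_image[OF inj]) (auto simp: occurs_map p123_def)
  also have "\<dots> = card {xs \<in> A. \<not> occurs p123 xs}"
    using card_avoid_rev[OF assms, of p123] by (simp add: p123_def conj_commute)
  finally show ?thesis .
qed

section \<open>From permutations to predicates\<close>

lemma contains_pattern_iff_occurs:
  "contains_pattern xs \<pi> \<longleftrightarrow> occurs (\<lambda>x y z.
     (\<pi> 1 < \<pi> 2 \<longrightarrow> x < y) \<and> (\<pi> 2 < \<pi> 1 \<longrightarrow> y < x) \<and>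
     (\<pi> 1 < \<pi> 3 \<longrightarrow> x < z) \<and> (\<pi> 3 < \<pi> 1 \<longrightarrow> z < x) \<and>
     (\<pi> 2 < \<pi> 3 \<longrightarrow> y < z) \<and> (\<pi> 3 < \<pi> 2 \<longrightarrow> z < y)) xs" (is "_ \<longleftrightarrow> ?R")
proof
  assume "contains_pattern xs \<pi>"
  then obtain i :: "nat \<Rightarrow> nat" where "i 1 < i 2 \<and> i 2 < i 3 \<and> i 3 < length xs \<and>
      (\<forall>a\<in>{1, 2, 3}. \<forall>b\<in>{1, 2, 3}. \<pi> a < \<pi> b \<longrightarrow> xs ! i a < xs ! i b)"
    unfolding contains_pattern_def by blast
  then show ?R
    unfolding occurs_def by (intro exI[of _ "i 1"] exI[of _ "i 2"] exI[of _ "i 3"]) simp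
next
  assume ?R
  then obtain i j k where "i < j \<and> j < k \<and> k < length xs \<and>
     (\<pi> 1 < \<pi> 2 \<longrightarrow> xs ! i < xs ! j) \<and> (\<pi> 2 < \<pi> 1 \<longrightarrow> xs ! j < xs ! i) \<and>
     (\<pi> 1 < \<pi> 3 \<longrightarrow> xs ! i < xs ! k) \<and> (\<pi> 3 < \<pi> 1 \<longrightarrow> xs ! k < xs ! i) \<and>
     (\<pi> 2 < \<pi> 3 \<longrightarrow> xs ! j < xs ! k) \<and> (\<pi> 3 < \<pi> 2 \<longrightarrow> xs ! k < xs ! j)"
    unfolding occurs_def by blast
  then show "contains_pattern xs \<pi>"
    unfolding contains_pattern_def
    \<comment> \<open>Only the values at 1, 2 and 3 are read, so \<open>k\<close> can be the
      default.\<close>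
    by (intro exI[of _ "\<lambda>a. if a = 1 then i else if a = 2 then j else k"]) simp
qed

lemma card_avoids_pattern:
  assumes "\<pi> permutes {1, 2, 3}" and A: "perm_closed A"
  shows "card {xs \<in> A. avoids_pattern xs \<pi>} = card {xs \<in> A. \<not> occurs p123 xs}"
proof -
  define P where "P = (\<lambda>x y z :: nat.
     (\<pi> 1 < \<pi> 2 \<longrightarrow> x < y) \<and> (\<pi> 2 < \<pi> 1 \<longrightarrow> y < x) \<and>
     (\<pi> 1 < \<pi> 3 \<longrightarrow> x < z) \<and> (\<pi> 3 < \<pi> 1 \<longrightarrow> z < x) \<and>
     (\<pi> 2 < \<pi> 3 \<longrightarrow> y < z) \<and> (\<pi> 3 < \<pi> 2 \<longrightarrow> z < y))"
  have "\<pi> 1 \<in> {1, 2, 3}" "\<pi> 2 \<in> {1, 2, 3}" "\<pi> 3 \<in> {1, 2, 3}"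
    using permutes_in_image[OF assms(1)] by blast+
  moreover have "\<pi> 1 \<noteq> \<pi> 2" "\<pi> 1 \<noteq> \<pi> 3" "\<pi> 2 \<noteq> \<pi> 3"
    using permutes_inj[OF assms(1)] by (simp_all add: inj_eq)
  ultimately consider
    "\<pi> 1 < \<pi> 2" "\<pi> 2 < \<pi> 3" | "\<pi> 1 < \<pi> 3" "\<pi> 3 < \<pi> 2" | "\<pi> 2 < \<pi> 1" "\<pi> 1 < \<pi> 3" |
    "\<pi> 3 < \<pi> 2" "\<pi> 2 < \<pi> 1" | "\<pi> 2 < \<pi> 3" "\<pi> 3 < \<pi> 1" | "\<pi> 3 < \<pi> 1" "\<pi> 1 < \<pi> 2"
    by linarith
  \<comment> \<open>The first three orders are 123, 132, 213; the last three are 321, 312, 231, the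
    reversals of 123, 213, 132.\<close>
  then consider Q where "Q \<in> {p123, p132, p213}" "P = Q"
    | Q where "Q \<in> {p123, p132, p213}" "P = (\<lambda>x y z. Q z y x)"
  proof cases
    case 1
    then have "P = p123" by (auto simp: P_def p123_def fun_eq_iff)
    then show ?thesis using that(1) by blast
  next
    case 2
    then have "P = p132" by (auto simp: P_def p132_def fun_eq_iff)
    then show ?thesis using that(1) by blast
  next
    case 3
    then have "P = p213" by (auto simp: P_def p213_def fun_eq_iff)
    then show ?thesis using that(1) by blast
  next
    case 4
    then have "P = (\<lambda>x y z. p123 z y x)" by (auto simp: P_def p123_def fun_eq_iff)
    then show ?thesis using that(2) by blast
  next
    case 5
    then have "P = (\<lambda>x y z. p213 z y x)" by (auto simp: P_def p213_def fun_eq_iff)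
    then show ?thesis using that(2) by blast
  next
    case 6
    then have "P = (\<lambda>x y z. p132 z y x)" by (auto simp: P_def p132_def fun_eq_iff)
    then show ?thesis using that(2) by blast
  qed
  then have "card {xs \<in> A. \<not> occurs P xs} = card {xs \<in> A. \<not> occurs p123 xs}"
  proof cases
    case 1
    then show ?thesis
      using card_avoid_123_132[OF A] card_avoid_123_213[OF A] by auto
  next
    case (2 Q)
    then show ?thesis
      using card_avoid_123_132[OF A] card_avoid_123_213[OF A] card_avoid_rev[OF A, of Q] by auto
  qed
  then show ?thesis
    by (simp add: avoids_pattern_def contains_pattern_iff_occurs P_def)
qed

section \<open>Compositions and their number\<close>

lemma perm_closed_compositions:
  "perm_closed (pos_compositions n k)" "perm_closed (nonneg_compositions n k)"
  unfolding perm_closed_def pos_compositions_def nonneg_compositions_def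
  by (auto dest: mset_eq_length mset_eq_setD simp flip: sum_mset_sum_list)

lemma card_nonneg_compositions: "card (nonneg_compositions n k) = (n + k - 1) choose n"
  using card_length_sum_list[of k n] by (simp add: nonneg_compositions_def)

lemma sum_list_map_Suc: "sum_list (map Suc xs) = sum_list xs + length xs"
  by (induction xs) auto

lemma pos_compositions_eq_image:
  assumes "k \<le> n"
  shows "pos_compositions n k = map Suc ` nonneg_compositions (n - k) k"
proof (intro equalityI subsetI)
  fix xs assume xs: "xs \<in> pos_compositions n k"
  \<comment> \<open>Positivity of the parts keeps the subtraction from truncating.\<close>
  then have eq: "map Suc (map (\<lambda>x. x - 1) xs) = xs"
    by (auto simp: pos_compositions_def intro!: map_idI)
  have "sum_list xs = sum_list (map (\<lambda>x. x - 1) xs) + length xs"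
    using sum_list_map_Suc[of "map (\<lambda>x. x - 1) xs"] eq by simp
  then have "map (\<lambda>x. x - 1) xs \<in> nonneg_compositions (n - k) k"
    using xs by (auto simp: pos_compositions_def nonneg_compositions_def)
  with eq show "xs \<in> map Suc ` nonneg_compositions (n - k) k"
    by (metis image_eqI)
qed (use assms in \<open>auto simp: pos_compositions_def nonneg_compositions_def sum_list_map_Suc\<close>)

text \<open>The case \<open>n = 0\<close> is separate because \<open>n - 1\<close> truncates to 0:
  for \<open>k = 1\<close> the binomial would be 1, while 0 has no composition into positive
  parts.\<close>

lemma card_pos_compositions:
  assumes "k \<ge> 1"
  shows "card (pos_compositions n k) = (if n = 0 then 0 else (n - 1) choose (k - 1))"
proof (cases "k \<le> n")
  case True
  have "card (pos_compositions n k) = (n - 1) choose (n - k)"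
    using True card_image[of "map Suc" "nonneg_compositions (n - k) k"]
    by (simp add: pos_compositions_eq_image card_nonneg_compositions inj_on_subset[of _ UNIV])
  also have "\<dots> = (n - 1) choose (k - 1)"
    using True assms by (subst binomial_symmetric) auto
  finally show ?thesis
    using True assms by simp
next
  case False
  \<comment> \<open>More positive parts than \<open>n\<close> are impossible; for
    \<open>n > 0\<close> the binomial vanishes too, as \<open>n - 1 < k - 1\<close>.\<close>
  have "length xs \<le> sum_list xs" if "\<forall>x\<in>set xs. 0 < x" for xs :: "nat list"
    using that by (induction xs) auto
  then have "pos_compositions n k = {}"
    using False unfolding pos_compositions_def by blast
  then show ?thesis
    using False by auto
qed

theorem theorem2:
  fixes n k :: nat and \<pi> \<sigma> :: "nat \<Rightarrow> nat"
  assumes "k \<ge> 1" and "\<pi> permutes {1, 2, 3}" and "\<sigma> permutes {1, 2, 3}"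
  shows "(card (pos_compositions n k) = (if n = 0 then 0 else (n - 1) choose (k - 1)) \<and>
      card {xs \<in> pos_compositions n k. avoids_pattern xs \<pi>} =
      card {xs \<in> pos_compositions n k. avoids_pattern xs \<sigma>}) \<and>
    (card (nonneg_compositions n k) = (n + k - 1) choose n \<and>
      card {xs \<in> nonneg_compositions n k. avoids_pattern xs \<pi>} =
      card {xs \<in> nonneg_compositions n k. avoids_pattern xs \<sigma>})"
  using card_avoids_pattern[OF assms(2)] card_avoids_pattern[OF assms(3)]
    perm_closed_compositions card_pos_compositions[OF assms(1)] card_nonneg_compositions
  by simp

end
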